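(* Let $\mathsf{MLO}$ be the continuous-logic theory, in the metric language $\mathcal{L}_{\leq}=\{d_\leq, r\}$ (two binary $[0,1]$-valued predicates), consisting of the conditions (1) $\sup_{x,y} |(r(x,y) + r(y,x)) - d(x,y)| = 0$; (2) $\sup_{x,y} \min\{r(x,y), r(y,x)\} = 0$; (3) $\sup_{x,y,z} \big(r(x,z)\ \dot- \ (r(x,y) + r(y,z))\big) = 0$; (4) $\sup_{x,y}|d_\leq(x,y) - \inf_{z}\max(r(x,z),r(z,y))| = 0$. Then the models of $\mathsf{MLO}$ are exactly the complete, bounded metric linear orders. Precisely: if $(M,d,\leq)$ is a metric linear order whose metric is complete of diameter at most $1$, and $r$, $d_\leq$ are interpreted as the ray predicate and the distance predicate to $\{(x,y):x\le y\}$, then the resulting structure satisfies $\mathsf{MLO}$; conversely, if $(M;d,d_\leq,r)\models\mathsf{MLO}$, then the relation $x\leq y :\iff r(x,y)=0$ is a linear order on $M$ for which every open metric ball is order-convex.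
   Context: A metric structure is a complete metric space of diameter at most $1$ with uniformly continuous $[0,1]$-valued predicates; a condition $\phi=0$ holds in $M$ if the sentence $\phi$ evaluates to $0$; $a\dot- b=\max(a-b,0)$. A metric linear order is a set $M$ with a linear order $\leq$ and a metric $d$ such that every open ball in the metric is order-convex. In a metric linear order, $r(x,y)=\inf_{z\le y} d(x,z)$ is the distance from $x$ to the ray $(-\infty,y]$, and $d_\leq(x,y)=\inf_{w\le z}\max(d(x,w),d(y,z))$ is the distance from $(x,y)$ to $\{(w,z):w\le z\}$ in the max-metric on $M^2$. *)

theory Defs
  imports "HOL-Analysis.Analysis"
begin

section \<open>Continuous logic over the language with two binary predicate symbols\<close>

datatype mlo_symbol = DLe | Ray

text \<open>Variables are natural numbers.\<close>

datatype mlo_formula =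
    Dist nat nat
  | Atom mlo_symbol nat nat
  | Plus mlo_formula mlo_formula
  | Monus mlo_formula mlo_formula
  | AbsDiff mlo_formula mlo_formula
  | MaxF mlo_formula mlo_formula
  | MinF mlo_formula mlo_formula
  | SupF nat mlo_formula
  | InfF nat mlo_formula

text \<open>
  Addition is not truncated, so intermediate values are real numbers. Over the empty universe
  the supremum is \<open>0\<close> and the infimum is \<open>1\<close>, as in the lattice \<open>[0,1]\<close>; in HOL
  the real supremum of the empty set is unspecified.
\<close>

fun formula_value ::
  "'a set \<Rightarrow> ('a \<Rightarrow> 'a \<Rightarrow> real) \<Rightarrow> (mlo_symbol \<Rightarrow> 'a \<Rightarrow> 'a \<Rightarrow> real) \<Rightarrow> (nat \<Rightarrow> 'a) \<Rightarrow> mlo_formula \<Rightarrow> real"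
where
  "formula_value M d I \<sigma> (Dist i j) = d (\<sigma> i) (\<sigma> j)"
| "formula_value M d I \<sigma> (Atom P i j) = I P (\<sigma> i) (\<sigma> j)"
| "formula_value M d I \<sigma> (Plus \<phi> \<psi>) = formula_value M d I \<sigma> \<phi> + formula_value M d I \<sigma> \<psi>"
| "formula_value M d I \<sigma> (Monus \<phi> \<psi>) =
     max (formula_value M d I \<sigma> \<phi> - formula_value M d I \<sigma> \<psi>) 0"
| "formula_value M d I \<sigma> (AbsDiff \<phi> \<psi>) =
     \<bar>formula_value M d I \<sigma> \<phi> - formula_value M d I \<sigma> \<psi>\<bar>"
| "formula_value M d I \<sigma> (MaxF \<phi> \<psi>) = max (formula_value M d I \<sigma> \<phi>) (formula_value M d I \<sigma> \<psi>)"
| "formula_value M d I \<sigma> (MinF \<phi> \<psi>) = min (formula_value M d I \<sigma> \<phi>) (formula_value M d I \<sigma> \<psi>)"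
| "formula_value M d I \<sigma> (SupF i \<phi>) =
     (if M = {} then 0 else SUP a\<in>M. formula_value M d I (\<sigma>(i := a)) \<phi>)"
| "formula_value M d I \<sigma> (InfF i \<phi>) =
     (if M = {} then 1 else INF a\<in>M. formula_value M d I (\<sigma>(i := a)) \<phi>)"

definition complete_diam_le_1 :: "'a set \<Rightarrow> ('a \<Rightarrow> 'a \<Rightarrow> real) \<Rightarrow> bool" where
  "complete_diam_le_1 M d \<longleftrightarrow>
     Metric_space M d \<and> Metric_space.mcomplete M d \<and> (\<forall>x\<in>M. \<forall>y\<in>M. d x y \<le> 1)"

definition unif_continuous_pred :: "'a set \<Rightarrow> ('a \<Rightarrow> 'a \<Rightarrow> real) \<Rightarrow> ('a \<Rightarrow> 'a \<Rightarrow> real) \<Rightarrow> bool" where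
  "unif_continuous_pred M d P \<longleftrightarrow>
     (\<forall>\<epsilon>>0. \<exists>\<delta>>0. \<forall>x\<in>M. \<forall>x'\<in>M. \<forall>y\<in>M. \<forall>y'\<in>M.
        max (d x x') (d y y') < \<delta> \<longrightarrow> \<bar>P x y - P x' y'\<bar> < \<epsilon>)"

definition metric_structure ::
  "'a set \<Rightarrow> ('a \<Rightarrow> 'a \<Rightarrow> real) \<Rightarrow> (mlo_symbol \<Rightarrow> 'a \<Rightarrow> 'a \<Rightarrow> real) \<Rightarrow> bool" where
  "metric_structure M d I \<longleftrightarrow>
     complete_diam_le_1 M d \<and>
     (\<forall>P. (\<forall>x\<in>M. \<forall>y\<in>M. I P x y \<in> {0..1}) \<and> unif_continuous_pred M d (I P))"

text \<open>
  A theory is a set of sentences \<open>\<phi>\<close>, each standing for the condition \<open>\<phi> = 0\<close>.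
  The value of a sentence does not depend on the assignment \<open>\<sigma>\<close>.
\<close>

definition models ::
  "'a set \<Rightarrow> ('a \<Rightarrow> 'a \<Rightarrow> real) \<Rightarrow> (mlo_symbol \<Rightarrow> 'a \<Rightarrow> 'a \<Rightarrow> real) \<Rightarrow> mlo_formula set \<Rightarrow> bool" where
  "models M d I T \<longleftrightarrow>
     metric_structure M d I \<and> (\<forall>\<phi>\<in>T. \<forall>\<sigma>. formula_value M d I \<sigma> \<phi> = 0)"

definition MLO :: "mlo_formula set" where
  "MLO =
    { SupF 0 (SupF 1 (AbsDiff (Plus (Atom Ray 0 1) (Atom Ray 1 0)) (Dist 0 1))),
      SupF 0 (SupF 1 (MinF (Atom Ray 0 1) (Atom Ray 1 0))),
      SupF 0 (SupF 1 (SupF 2 (Monus (Atom Ray 0 2) (Plus (Atom Ray 0 1) (Atom Ray 1 2))))),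
      SupF 0 (SupF 1 (AbsDiff (Atom DLe 0 1) (InfF 2 (MaxF (Atom Ray 0 2) (Atom Ray 2 1))))) }"

section \<open>Metric linear orders\<close>

definition order_convex :: "'a set \<Rightarrow> 'a rel \<Rightarrow> 'a set \<Rightarrow> bool" where
  "order_convex M L B \<longleftrightarrow>
     (\<forall>x\<in>B. \<forall>z\<in>B. \<forall>y\<in>M. (x, y) \<in> L \<and> (y, z) \<in> L \<longrightarrow> y \<in> B)"

text \<open>The order \<open>\<le>\<close> is the relation \<open>L\<close>: \<open>x \<le> y\<close> means \<open>(x, y) \<in> L\<close>.\<close>

definition metric_linear_order :: "'a set \<Rightarrow> ('a \<Rightarrow> 'a \<Rightarrow> real) \<Rightarrow> 'a rel \<Rightarrow> bool" where
  "metric_linear_order M d L \<longleftrightarrow>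
     Metric_space M d \<and> linear_order_on M L \<and>
     (\<forall>c\<in>M. \<forall>\<epsilon>>0. order_convex M L (Metric_space.mball M d c \<epsilon>))"

definition ray_pred :: "'a set \<Rightarrow> ('a \<Rightarrow> 'a \<Rightarrow> real) \<Rightarrow> 'a rel \<Rightarrow> 'a \<Rightarrow> 'a \<Rightarrow> real" where
  "ray_pred M d L x y = (INF z\<in>{z\<in>M. (z, y) \<in> L}. d x z)"

definition dle_pred :: "'a set \<Rightarrow> ('a \<Rightarrow> 'a \<Rightarrow> real) \<Rightarrow> 'a rel \<Rightarrow> 'a \<Rightarrow> 'a \<Rightarrow> real" where
  "dle_pred M d L x y = (INF (w, z)\<in>{(w, z). w \<in> M \<and> z \<in> M \<and> (w, z) \<in> L}. max (d x w) (d y z))"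

fun order_interp ::
  "'a set \<Rightarrow> ('a \<Rightarrow> 'a \<Rightarrow> real) \<Rightarrow> 'a rel \<Rightarrow> mlo_symbol \<Rightarrow> 'a \<Rightarrow> 'a \<Rightarrow> real" where
  "order_interp M d L DLe = dle_pred M d L"
| "order_interp M d L Ray = ray_pred M d L"

end

theory Submission
  imports Defs
begin

text \<open>
  Convexity of balls says that \<open>d\<close> is monotone along the order in both arguments, so in a metric
  linear order \<open>r(x,y)\<close> is \<open>0\<close> if \<open>x \<le> y\<close> and \<open>d(x,y)\<close> otherwise; the axioms follow from this
  formula. Conversely, axioms (1)--(3) make \<open>r(x,y) = 0\<close> a linear order, and for \<open>x \<le> y \<le> z\<close> the
  triangle inequality for \<open>r\<close> bounds \<open>d(c,y)\<close> by \<open>d(c,z)\<close> if \<open>c \<le> y\<close> and by \<open>d(c,x)\<close> if \<open>y \<le> c\<close>,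
  whence balls are convex.
\<close>

section \<open>Suprema over a possibly empty universe\<close>

definition universe_Sup :: "'a set \<Rightarrow> ('a \<Rightarrow> real) \<Rightarrow> real" where
  "universe_Sup M f = (if M = {} then 0 else SUP a\<in>M. f a)"

text \<open>Inner suprema inherit the bounds of their body, which lets the vanishing criterion below
  be applied to nested quantifiers. The condition \<open>0 \<le> B\<close> covers the value 0 over
  the empty universe.\<close>

lemma universe_Sup_bounds:
  assumes "\<And>a. a \<in> M \<Longrightarrow> 0 \<le> f a \<and> f a \<le> B" "0 \<le> B"
  shows "0 \<le> universe_Sup M f \<and> universe_Sup M f \<le> B"
proof (cases "M = {}")
  case False
  then obtain a where a: "a \<in> M" by blast
  have "bdd_above (f ` M)" using assms(1) by (intro bdd_aboveI2) blast
  then have "f a \<le> (SUP a\<in>M. f a)" using a by (intro cSUP_upper)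
  moreover have "(SUP a\<in>M. f a) \<le> B" using False assms(1) by (intro cSUP_least) auto
  ultimately show ?thesis using False assms(1)[OF a] by (simp add: universe_Sup_def)
qed (use assms(2) in \<open>simp add: universe_Sup_def\<close>)

text \<open>Each value is squeezed between 0 and the supremum. The bound \<open>B\<close> makes the
  supremum a genuine upper bound, since the real \<open>SUP\<close> of an unbounded set is
  unspecified.\<close>

lemma universe_Sup_eq_0_iff:
  assumes "\<And>a. a \<in> M \<Longrightarrow> 0 \<le> f a \<and> f a \<le> B"
  shows "universe_Sup M f = 0 \<longleftrightarrow> (\<forall>a\<in>M. f a = 0)"
proof
  assume 0: "universe_Sup M f = 0"
  show "\<forall>a\<in>M. f a = 0"
  proof
    fix a assume a: "a \<in> M"
    have "bdd_above (f ` M)" using assms by (intro bdd_aboveI2) blast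
    then have "f a \<le> universe_Sup M f"
      using a by (auto simp: universe_Sup_def intro: cSUP_upper)
    then show "f a = 0" using 0 assms[OF a] by linarith
  qed
qed (auto simp: universe_Sup_def)

lemma universe_Sup2_eq_0_iff:
  assumes "\<And>a b. a \<in> M \<Longrightarrow> b \<in> M \<Longrightarrow> 0 \<le> f a b \<and> f a b \<le> B" "0 \<le> B"
  shows "universe_Sup M (\<lambda>a. universe_Sup M (f a)) = 0 \<longleftrightarrow> (\<forall>a\<in>M. \<forall>b\<in>M. f a b = 0)"
proof -
  have "universe_Sup M (\<lambda>a. universe_Sup M (f a)) = 0 \<longleftrightarrow> (\<forall>a\<in>M. universe_Sup M (f a) = 0)"
    using assms by (intro universe_Sup_eq_0_iff[where B = B] universe_Sup_bounds)
  also have "\<dots> \<longleftrightarrow> (\<forall>a\<in>M. \<forall>b\<in>M. f a b = 0)"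
    using assms by (intro ball_cong universe_Sup_eq_0_iff[where B = B]) auto
  finally show ?thesis .
qed

lemma universe_Sup3_eq_0_iff:
  assumes "\<And>a b c. a \<in> M \<Longrightarrow> b \<in> M \<Longrightarrow> c \<in> M \<Longrightarrow> 0 \<le> f a b c \<and> f a b c \<le> B" "0 \<le> B"
  shows "universe_Sup M (\<lambda>a. universe_Sup M (\<lambda>b. universe_Sup M (f a b))) = 0
    \<longleftrightarrow> (\<forall>a\<in>M. \<forall>b\<in>M. \<forall>c\<in>M. f a b c = 0)"
proof -
  have "universe_Sup M (\<lambda>a. universe_Sup M (\<lambda>b. universe_Sup M (f a b))) = 0
    \<longleftrightarrow> (\<forall>a\<in>M. \<forall>b\<in>M. universe_Sup M (f a b) = 0)"
    using assms by (intro universe_Sup2_eq_0_iff[where B = B] universe_Sup_bounds)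
  also have "\<dots> \<longleftrightarrow> (\<forall>a\<in>M. \<forall>b\<in>M. \<forall>c\<in>M. f a b c = 0)"
    using assms by (intro ball_cong universe_Sup_eq_0_iff[where B = B]) auto
  finally show ?thesis .
qed

text \<open>Bridge from syntax to pointwise conditions, on which both directions of the theorem
  rest. In a metric structure the body of each axiom is non-negative and bounded, so its iterated
  supremum vanishes exactly when the body does everywhere.\<close>

lemma models_MLO_iff:
  "models M d I MLO \<longleftrightarrow> metric_structure M d I \<and>
    (\<forall>x\<in>M. \<forall>y\<in>M. I Ray x y + I Ray y x = d x y) \<and>
    (\<forall>x\<in>M. \<forall>y\<in>M. min (I Ray x y) (I Ray y x) = 0) \<and>
    (\<forall>x\<in>M. \<forall>y\<in>M. \<forall>z\<in>M. I Ray x z \<le> I Ray x y + I Ray y z) \<and>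
    (\<forall>x\<in>M. \<forall>y\<in>M. I DLe x y = (INF z\<in>M. max (I Ray x z) (I Ray z y)))"
proof (cases "metric_structure M d I")
  case True
  then interpret Metric_space M d
    by (simp add: metric_structure_def complete_diam_le_1_def)
  have I: "0 \<le> I P x y" "I P x y \<le> 1" if "x \<in> M" "y \<in> M" for P x y
    using True that by (auto simp: metric_structure_def)
  have d: "0 \<le> d x y" "d x y \<le> 1" if "x \<in> M" "y \<in> M" for x y
    using True that by (auto simp: metric_structure_def complete_diam_le_1_def)
  have inf: "0 \<le> (INF z\<in>M. max (I Ray x z) (I Ray z y))"
    "(INF z\<in>M. max (I Ray x z) (I Ray z y)) \<le> 1" if "x \<in> M" "y \<in> M" for x y
  proof -
    show "0 \<le> (INF z\<in>M. max (I Ray x z) (I Ray z y))"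
      using that I by (intro cINF_greatest) (auto simp: le_max_iff_disj)
    have "bdd_below ((\<lambda>z. max (I Ray x z) (I Ray z y)) ` M)"
      using that I by (intro bdd_belowI2[where m = 0]) (auto simp: le_max_iff_disj)
    then show "(INF z\<in>M. max (I Ray x z) (I Ray z y)) \<le> 1"
      using that I by (intro cINF_lower2[OF _ \<open>x \<in> M\<close>]) auto
  qed
  \<comment> \<open>The bound 3 is crude: the body combines three quantities from the unit
    interval.\<close>
  have "universe_Sup M (\<lambda>x. universe_Sup M (\<lambda>y. \<bar>I Ray x y + I Ray y x - d x y\<bar>)) = 0
      \<longleftrightarrow> (\<forall>x\<in>M. \<forall>y\<in>M. \<bar>I Ray x y + I Ray y x - d x y\<bar> = 0)"
    by (rule universe_Sup2_eq_0_iff[where B = 3]) (use I d in \<open>smt (verit)\<close>)+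
  moreover have "universe_Sup M (\<lambda>x. universe_Sup M (\<lambda>y. min (I Ray x y) (I Ray y x))) = 0
      \<longleftrightarrow> (\<forall>x\<in>M. \<forall>y\<in>M. min (I Ray x y) (I Ray y x) = 0)"
    by (rule universe_Sup2_eq_0_iff[where B = 1]) (use I in \<open>smt (verit)\<close>)+
  moreover have "universe_Sup M (\<lambda>x. universe_Sup M (\<lambda>y. universe_Sup M
        (\<lambda>z. max (I Ray x z - (I Ray x y + I Ray y z)) 0))) = 0
      \<longleftrightarrow> (\<forall>x\<in>M. \<forall>y\<in>M. \<forall>z\<in>M. max (I Ray x z - (I Ray x y + I Ray y z)) 0 = 0)"
    by (rule universe_Sup3_eq_0_iff[where B = 1]) (use I in \<open>smt (verit)\<close>)+
  moreover have "universe_Sup M (\<lambda>x. universe_Sup M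
        (\<lambda>y. \<bar>I DLe x y - (INF z\<in>M. max (I Ray x z) (I Ray z y))\<bar>)) = 0
      \<longleftrightarrow> (\<forall>x\<in>M. \<forall>y\<in>M. \<bar>I DLe x y - (INF z\<in>M. max (I Ray x z) (I Ray z y))\<bar> = 0)"
    by (rule universe_Sup2_eq_0_iff[where B = 1]) (use I inf in \<open>smt (verit)\<close>)+
  moreover have "max (a - b) 0 = 0 \<longleftrightarrow> a \<le> b" for a b :: real
    by auto
  \<comment> \<open>Over the empty universe every axiom takes the default value 0 of its outer
    \<open>SupF\<close> and the pointwise conditions are vacuous, so the default 1 of
    \<open>InfF\<close> never enters.\<close>
  ultimately show ?thesis
    using True by (cases "M = {}") (auto simp: models_def MLO_def universe_Sup_def)
qed (simp add: models_def)

section \<open>Rays in a metric linear order\<close>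

locale metric_linear_order_space = Metric_space M d
  for M :: "'a set" and d :: "'a \<Rightarrow> 'a \<Rightarrow> real" +
  fixes L :: "'a rel"
  assumes mlo: "metric_linear_order M d L"
begin

lemma linear_order: "linear_order_on M L"
  and convex_ball: "c \<in> M \<Longrightarrow> 0 < e \<Longrightarrow> order_convex M L (mball c e)"
  using mlo by (simp_all add: metric_linear_order_def)

lemma L_antisym: "(x, y) \<in> L \<Longrightarrow> (y, x) \<in> L \<Longrightarrow> x = y"
  using linear_order by (meson order_on_defs antisymD)

lemma L_trans: "(x, y) \<in> L \<Longrightarrow> (y, z) \<in> L \<Longrightarrow> (x, z) \<in> L"
  using linear_order by (meson order_on_defs transD)

lemma L_refl: "x \<in> M \<Longrightarrow> (x, x) \<in> L"
  using linear_order by (meson order_on_defs refl_onD)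

lemma L_total: "x \<in> M \<Longrightarrow> y \<in> M \<Longrightarrow> (x, y) \<in> L \<or> (y, x) \<in> L"
  using linear_order L_refl by (metis linear_order_on_def total_on_def)

text \<open>An open ball about \<open>c\<close> of radius slightly larger than \<open>d c x\<close>
  contains \<open>c\<close> and \<open>x\<close>, hence by convexity every point between them. The
  slack \<open>e\<close> is needed because the ball is open, and then tends to 0.\<close>

lemma dist_le_dist_of_between:
  assumes c: "c \<in> M" and M: "x \<in> M" "y \<in> M"
    and "(c, y) \<in> L \<and> (y, x) \<in> L \<or> (x, y) \<in> L \<and> (y, c) \<in> L"
  shows "d c y \<le> d c x"
proof (rule field_le_epsilon)
  fix e :: real assume "0 < e"
  then have pos: "0 < d c x + e" using nonneg[of c x] by linarith
  then have "order_convex M L (mball c (d c x + e))"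
    using c convex_ball by blast
  moreover have "c \<in> mball c (d c x + e)" "x \<in> mball c (d c x + e)"
    using c M pos \<open>0 < e\<close> by auto
  ultimately have "y \<in> mball c (d c x + e)"
    using assms(4) M(2) unfolding order_convex_def by blast
  then show "d c y \<le> d c x + e" by simp
qed

text \<open>The infimum is attained: at \<open>x\<close> itself if \<open>x\<close> lies on the ray,
  and otherwise at the endpoint \<open>y\<close>, which lies between \<open>x\<close> and every
  point of the ray.\<close>

lemma ray_pred_eq:
  assumes "x \<in> M" "y \<in> M"
  shows "ray_pred M d L x y = (if (x, y) \<in> L then 0 else d x y)"
  unfolding ray_pred_def
proof (rule cInf_eq_minimum)
  show "(if (x, y) \<in> L then 0 else d x y) \<in> d x ` {z \<in> M. (z, y) \<in> L}"
  proof (cases "(x, y) \<in> L")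
    case True
    then show ?thesis using assms by (intro image_eqI[of _ _ x]) auto
  next
    case False
    then show ?thesis using assms L_refl by (intro image_eqI[of _ _ y]) auto
  qed
next
  fix t assume "t \<in> d x ` {z \<in> M. (z, y) \<in> L}"
  then obtain z where z: "z \<in> M" "(z, y) \<in> L" "t = d x z" by blast
  show "(if (x, y) \<in> L then 0 else d x y) \<le> t"
    using dist_le_dist_of_between[OF assms(1) z(1) assms(2)] z L_total[OF assms] by auto
qed

abbreviation r where "r \<equiv> ray_pred M d L"

lemma ray_nonneg: "x \<in> M \<Longrightarrow> y \<in> M \<Longrightarrow> 0 \<le> r x y"
  and ray_le_dist: "x \<in> M \<Longrightarrow> y \<in> M \<Longrightarrow> r x y \<le> d x y"
  and ray_eq_0: "x \<in> M \<Longrightarrow> y \<in> M \<Longrightarrow> (x, y) \<in> L \<Longrightarrow> r x y = 0"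
  by (auto simp: ray_pred_eq)

lemma ray_sum: "x \<in> M \<Longrightarrow> y \<in> M \<Longrightarrow> r x y + r y x = d x y"
  using L_total[of x y] L_antisym[of x y] by (cases "x = y") (auto simp: ray_pred_eq commute)

lemma ray_min: "x \<in> M \<Longrightarrow> y \<in> M \<Longrightarrow> min (r x y) (r y x) = 0"
  using L_total[of x y] by (auto simp: ray_pred_eq)

text \<open>Only \<open>z < x\<close> matters. If \<open>y \<le> z\<close>, then \<open>z\<close>
  lies between \<open>y\<close> and \<open>x\<close>, so \<open>d x z \<le> d x y\<close>; if
  \<open>x \<le> y\<close>, then \<open>x\<close> lies between \<open>z\<close> and
  \<open>y\<close>, so \<open>d x z \<le> d y z\<close>; if \<open>z < y < x\<close>, this is the
  triangle inequality of \<open>d\<close>.\<close>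

lemma ray_triangle:
  assumes M: "x \<in> M" "y \<in> M" "z \<in> M"
  shows "r x z \<le> r x y + r y z"
proof (cases "(x, z) \<in> L")
  case True
  then show ?thesis using M ray_nonneg[of x y] ray_nonneg[of y z] by (simp add: ray_eq_0)
next
  case False
  then have zx: "(z, x) \<in> L" using L_total M by blast
  consider "(y, z) \<in> L" | "(x, y) \<in> L" "(y, z) \<notin> L" | "(x, y) \<notin> L" "(y, z) \<notin> L" by blast
  then show ?thesis
  proof cases
    case 1
    then have "(x, y) \<notin> L" using False L_trans by blast
    then show ?thesis
      using 1 False M zx dist_le_dist_of_between[of x y z] by (simp add: ray_pred_eq)
  next
    case 2
    then show ?thesis
      using False M zx dist_le_dist_of_between[of z y x] by (simp add: ray_pred_eq commute)
  next
    case 3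
    then show ?thesis using False M triangle by (simp add: ray_pred_eq)
  qed
qed

section \<open>The distance to the order relation\<close>

lemma bdd_below_ray_max: "x \<in> M \<Longrightarrow> y \<in> M \<Longrightarrow> bdd_below ((\<lambda>z. max (r x z) (r z y)) ` M)"
  by (intro bdd_belowI2[where m = 0]) (auto simp: le_max_iff_disj ray_nonneg)

lemma bdd_below_dist_max: "bdd_below ((\<lambda>(w, z). max (d x w) (d y z)) ` A)"
  by (intro bdd_belowI2[where m = 0]) (auto simp: le_max_iff_disj)

lemma dle_pred_le:
  assumes "w \<in> M" "z \<in> M" "(w, z) \<in> L"
  shows "dle_pred M d L x y \<le> max (d x w) (d y z)"
  unfolding dle_pred_def
  using cINF_lower[OF bdd_below_dist_max[of x y], of "(w, z)"] assms by auto

lemma dle_pred_greatest: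
  assumes "x \<in> M" "\<And>w z. w \<in> M \<Longrightarrow> z \<in> M \<Longrightarrow> (w, z) \<in> L \<Longrightarrow> t \<le> max (d x w) (d y z)"
  shows "t \<le> dle_pred M d L x y"
  unfolding dle_pred_def
proof (rule cINF_greatest)
  show "{(w, z). w \<in> M \<and> z \<in> M \<and> (w, z) \<in> L} \<noteq> {}"
    using assms(1) L_refl[OF assms(1)] by blast
qed (use assms(2) in auto)

lemma dle_pred_eq:
  assumes M: "x \<in> M" "y \<in> M"
  shows "dle_pred M d L x y = (INF z\<in>M. max (r x z) (r z y))"
proof (rule antisym)
  show "dle_pred M d L x y \<le> (INF z\<in>M. max (r x z) (r z y))"
  proof (rule cINF_greatest)
    fix z assume z: "z \<in> M"
    \<comment> \<open>In each case an ordered pair is close enough to \<open>(x, y)\<close>: the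
      pair itself, then \<open>(y, y)\<close> when \<open>z \<le> y < x\<close>,
      \<open>(x, x)\<close> when \<open>y < x \<le> z\<close>, and \<open>(z, z)\<close> when
      \<open>y < z < x\<close>. Betweenness bounds \<open>d x y\<close> by \<open>d x z\<close> in
      the second case and by \<open>d z y\<close> in the third.\<close>
    consider "(x, y) \<in> L" | "(y, x) \<in> L" "(z, y) \<in> L" "(x, y) \<notin> L"
      | "(y, x) \<in> L" "(x, z) \<in> L" "(x, y) \<notin> L" | "(x, z) \<notin> L" "(z, y) \<notin> L"
      using L_total[OF M] by blast
    then show "dle_pred M d L x y \<le> max (r x z) (r z y)"
    proof cases
      case 1
      then show ?thesis
        using M z dle_pred_le[of x y x y] ray_nonneg[of x z] by (auto simp: le_max_iff_disj)
    next
      case 2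
      then have "(x, z) \<notin> L" using L_trans by blast
      then show ?thesis
        using 2 M z dle_pred_le[of y y x y] dist_le_dist_of_between[of x z y]
        by (auto simp: ray_pred_eq L_refl)
    next
      case 3
      then have "(z, y) \<notin> L" using L_trans by blast
      then show ?thesis
        using 3 M z dle_pred_le[of x x x y] dist_le_dist_of_between[of y z x]
        by (auto simp: ray_pred_eq L_refl commute)
    next
      case 4
      then show ?thesis
        using M z dle_pred_le[of z z x y] by (auto simp: ray_pred_eq L_refl commute)
    qed
  qed (use M in auto)
next
  show "(INF z\<in>M. max (r x z) (r z y)) \<le> dle_pred M d L x y"
  proof (rule dle_pred_greatest[OF M(1)])
    fix w z assume wz: "w \<in> M" "z \<in> M" "(w, z) \<in> L"
    \<comment> \<open>For an ordered pair \<open>(w, z)\<close> the point \<open>w\<close> serves as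
      the intermediate point: \<open>r w z = 0\<close>, so going from \<open>w\<close> to the ray
      below \<open>y\<close> costs at most \<open>r z y\<close>.\<close>
    have "r w y \<le> d y z"
      using ray_triangle[of w z y] ray_le_dist[of z y] wz M by (simp add: ray_eq_0 commute)
    then have "max (r x w) (r w y) \<le> max (d x w) (d y z)"
      using ray_le_dist[OF M(1) wz(1)] by linarith
    then show "(INF z\<in>M. max (r x z) (r z y)) \<le> max (d x w) (d y z)"
      using cINF_lower2[OF bdd_below_ray_max[OF M] wz(1)] by blast
  qed
qed

section \<open>Uniform continuity of the two predicates\<close>

lemma ray_pred_lipschitz:
  assumes "x \<in> M" "y \<in> M" "x' \<in> M" "y' \<in> M"
  shows "r x y - r x' y' \<le> d x x' + d y y'"
  \<comment> \<open>The path from \<open>x\<close> through \<open>x'\<close> and \<open>y'\<close>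
    to \<open>y\<close> gives \<open>r x y \<le> r x x' + r x' y' + r y' y\<close>, and the outer
    terms are at most distances.\<close>
  using ray_triangle[of x x' y] ray_triangle[of x' y' y] ray_le_dist[of x x'] ray_le_dist[of y' y]
    assms by (simp add: commute)

text \<open>The distance to a fixed set is 1-Lipschitz, here in the max-metric: the triangle
  inequality is applied in each coordinate to every competing pair.\<close>

lemma dle_pred_lipschitz:
  assumes "x \<in> M" "y \<in> M" "x' \<in> M" "y' \<in> M"
  shows "dle_pred M d L x y - dle_pred M d L x' y' \<le> max (d x x') (d y y')"
proof -
  have "dle_pred M d L x y - max (d x x') (d y y') \<le> dle_pred M d L x' y'"
  proof (rule dle_pred_greatest[OF assms(3)])
    fix w z assume wz: "w \<in> M" "z \<in> M" "(w, z) \<in> L"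
    show "dle_pred M d L x y - max (d x x') (d y y') \<le> max (d x' w) (d y' z)"
      using dle_pred_le[OF wz, of x y] triangle[of x x' w] triangle[of y y' z] wz assms
      by linarith
  qed
  then show ?thesis by linarith
qed

lemma metric_structure_order_interp:
  assumes "complete_diam_le_1 M d"
  shows "metric_structure M d (order_interp M d L)"
proof -
  have d1: "d x y \<le> 1" if "x \<in> M" "y \<in> M" for x y
    using assms that by (auto simp: complete_diam_le_1_def)
  have "(\<forall>x\<in>M. \<forall>y\<in>M. order_interp M d L P x y \<in> {0..1}) \<and>
    unif_continuous_pred M d (order_interp M d L P)" for P
  proof (cases P)
    case DLe
    \<comment> \<open>The upper bound comes from the ordered pair \<open>(x, x)\<close>, at distance
      \<open>d y x\<close> from \<open>(x, y)\<close>.\<close>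
    have "0 \<le> dle_pred M d L x y" "dle_pred M d L x y \<le> 1" if "x \<in> M" "y \<in> M" for x y
      using dle_pred_greatest[of x 0 y] dle_pred_le[of x x x y] that d1[of y x]
      by (auto simp: le_max_iff_disj L_refl)
    moreover have "unif_continuous_pred M d (dle_pred M d L)"
      unfolding unif_continuous_pred_def
    proof (intro allI impI)
      fix e :: real assume e: "0 < e"
      have "\<bar>dle_pred M d L x y - dle_pred M d L x' y'\<bar> < e"
        if "x \<in> M" "y \<in> M" "x' \<in> M" "y' \<in> M" "max (d x x') (d y y') < e" for x y x' y'
        using dle_pred_lipschitz[of x y x' y'] dle_pred_lipschitz[of x' y' x y] that
          commute[of x x'] commute[of y y']
        by linarith
      then show "\<exists>\<delta>>0. \<forall>x\<in>M. \<forall>x'\<in>M. \<forall>y\<in>M. \<forall>y'\<in>M. max (d x x') (d y y') < \<delta> \<longrightarrow>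
          \<bar>dle_pred M d L x y - dle_pred M d L x' y'\<bar> < e"
        using e by (intro exI[of _ e]) auto
    qed
    ultimately show ?thesis using DLe by simp
  next
    case Ray
    have "0 \<le> r x y" "r x y \<le> 1" if "x \<in> M" "y \<in> M" for x y
      using ray_nonneg ray_le_dist[of x y] d1[of x y] that by auto
    moreover have "unif_continuous_pred M d r"
      unfolding unif_continuous_pred_def
    proof (intro allI impI)
      fix e :: real assume e: "0 < e"
      \<comment> \<open>Half of \<open>e\<close> is taken because the Lipschitz bound for
        \<open>r\<close> is a sum of two distances, whereas the one for \<open>dle_pred\<close> is
        their maximum.\<close>
      have "\<bar>r x y - r x' y'\<bar> < e"
        if "x \<in> M" "y \<in> M" "x' \<in> M" "y' \<in> M" "max (d x x') (d y y') < e / 2" for x y x' y'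
        using ray_pred_lipschitz[of x y x' y'] ray_pred_lipschitz[of x' y' x y] that
        by (simp add: commute)
      then show "\<exists>\<delta>>0. \<forall>x\<in>M. \<forall>x'\<in>M. \<forall>y\<in>M. \<forall>y'\<in>M. max (d x x') (d y y') < \<delta> \<longrightarrow>
          \<bar>r x y - r x' y'\<bar> < e"
        using e by (intro exI[of _ "e / 2"]) auto
    qed
    ultimately show ?thesis using Ray by simp
  qed
  then show ?thesis using assms by (simp add: metric_structure_def)
qed

end

lemma models_MLO_order_interp:
  assumes "metric_linear_order M d L" "complete_diam_le_1 M d"
  shows "models M d (order_interp M d L) MLO"
proof -
  interpret metric_linear_order_space M d L
    using assms
    by (simp add: metric_linear_order_space_def metric_linear_order_space_axioms_def
        metric_linear_order_def)
  show ?thesis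
    unfolding models_MLO_iff
    using metric_structure_order_interp[OF assms(2)] ray_sum ray_min ray_triangle dle_pred_eq
    by simp
qed

section \<open>The order defined by a model\<close>

lemma metric_linear_order_of_models_MLO:
  assumes "models M d I MLO"
  shows "metric_linear_order M d {(x, y). x \<in> M \<and> y \<in> M \<and> I Ray x y = 0}"
    (is "metric_linear_order M d ?L")
proof -
  let ?r = "I Ray"
  have ms: "metric_structure M d I"
    and sum: "\<And>x y. x \<in> M \<Longrightarrow> y \<in> M \<Longrightarrow> ?r x y + ?r y x = d x y"
    and min: "\<And>x y. x \<in> M \<Longrightarrow> y \<in> M \<Longrightarrow> min (?r x y) (?r y x) = 0"
    and tri: "\<And>x y z. x \<in> M \<Longrightarrow> y \<in> M \<Longrightarrow> z \<in> M \<Longrightarrow> ?r x z \<le> ?r x y + ?r y z"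
    using assms unfolding models_MLO_iff by blast+
  then interpret Metric_space M d
    by (simp add: metric_structure_def complete_diam_le_1_def)
  have pos: "0 \<le> ?r x y" if "x \<in> M" "y \<in> M" for x y
    using ms that by (auto simp: metric_structure_def)
  have total: "?r x y = 0 \<or> ?r y x = 0" if "x \<in> M" "y \<in> M" for x y
    using min[OF that] by linarith
  have "linear_order_on M ?L"
    unfolding order_on_defs
  proof (intro conjI)
    \<comment> \<open>Reflexivity is the diagonal case of axiom (2).\<close>
    show "refl_on M ?L" using total by (auto simp: refl_on_def)
    show "trans ?L"
    proof (rule transI)
      fix x y z assume "(x, y) \<in> ?L" "(y, z) \<in> ?L"
      then show "(x, z) \<in> ?L" using tri[of x y z] pos[of x z] by auto
    qed
    show "antisym ?L"
    proof (rule antisymI)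
      fix x y assume "(x, y) \<in> ?L" "(y, x) \<in> ?L"
      \<comment> \<open>By axiom (1), two vanishing rays give distance 0.\<close>
      then show "x = y" using sum[of x y] zero[of x y] by auto
    qed
    show "total_on M ?L" using total by (auto simp: total_on_def)
  qed auto
  moreover have "order_convex M ?L (mball c e)" for c e
    unfolding order_convex_def
  proof (intro ballI impI)
    fix x z y
    assume x: "x \<in> mball c e" and z: "z \<in> mball c e" and y: "y \<in> M"
      and "(x, y) \<in> ?L \<and> (y, z) \<in> ?L"
    then have xy: "?r x y = 0" and yz: "?r y z = 0" by auto
    have M: "c \<in> M" "x \<in> M" "z \<in> M" using x z by auto
    from total[OF M(1) y] have "d c y \<le> d c x \<or> d c y \<le> d c z"
    proof
      assume "?r c y = 0"
      \<comment> \<open>Here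
        \<open>d c y = ?r y c \<le> ?r y z + ?r z c = ?r z c \<le> d c z\<close>; the other case is
        the mirror image, with \<open>d c y = ?r c y\<close> and the path through
        \<open>x\<close>.\<close>
      then have "d c y \<le> d c z"
        using sum[of c y] tri[of y z c] sum[of c z] pos[of c z] yz M y by linarith
      then show ?thesis ..
    next
      assume "?r y c = 0"
      then have "d c y \<le> d c x"
        using sum[of c y] tri[of c x y] sum[of c x] pos[of x c] xy M y by linarith
      then show ?thesis ..
    qed
    then show "y \<in> mball c e" using x z y by auto
  qed
  ultimately show ?thesis
    by (simp add: metric_linear_order_def Metric_space_axioms)
qed

theorem theorem3p10:
  fixes M :: "'a set" and d :: "'a \<Rightarrow> 'a \<Rightarrow> real"
  shows "(\<forall>L. metric_linear_order M d L \<and> complete_diam_le_1 M d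
            \<longrightarrow> models M d (order_interp M d L) MLO) \<and>
         (\<forall>I. models M d I MLO
            \<longrightarrow> metric_linear_order M d {(x, y). x \<in> M \<and> y \<in> M \<and> I Ray x y = 0})"
  using models_MLO_order_interp metric_linear_order_of_models_MLO by blast

end
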